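(* Let $G$ be an augmented double star on $n$ vertices with $n\ge 12$, and let $\vec G$ be any orientation of $G$. Then $\lceil 2\sqrt n-1\rceil<\operatorname{th}(\vec G)<n$.
   Context: A double star is a tree with exactly two non-leaf vertices $a,b$ (adjacent to each other), each adjacent to at least one leaf. An augmented double star on $n$ vertices is obtained from a double star on $n-1$ vertices with internal vertices $a,b$ by deleting the edge $ab$, adding a new vertex $w$, and adding edges $aw$ and $bw$. An orientation of an undirected graph replaces each edge $\{u,v\}$ by exactly one of $(u,v)$, $(v,u)$. Zero forcing on a digraph: vertices are blue or white; a blue vertex $u$ with exactly one white out-neighbor $w$ may force $w$ ($u\to w$), turning it blue. A set $\mathcal F$ of forces is a set of forces of $B\subseteq V$ if, starting with exactly $B$ blue, the forces in $\mathcal F$ can be validly performed in some order after which no further force is possible. Put $\mathcal F^{[0]}=B$ and $\mathcal F^{[t+1]}=\mathcal F^{[t]}\cup\{w\notin\mathcal F^{[t]}:(u\to w)\in\mathcal F,\ u\in\mathcal F^{[t]},\ w$ the only out-neighbor of $u$ outside $\mathcal F^{[t]}\}$; $\operatorname{pt}(\Gamma;\mathcal F)$ is the least $t$ with $\mathcal F^{[t]}=V$ ($\infty$ if none); $\operatorname{pt}(\Gamma;B)=\min_{\mathcal F}\operatorname{pt}(\Gamma;\mathcal F)$. The throttling number is $\operatorname{th}(\Gamma)=\min_{B\subseteq V}(|B|+\operatorname{pt}(\Gamma;B))$. *)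

theory Defs
  imports Complex_Main "HOL-Library.Extended_Nat" "Graph_Theory.Digraph_Component"
begin

text \<open>
  A finite simple undirected graph is a \<open>pair_graph\<close>: a finite, loop-free digraph whose arc relation
  is symmetric, the edge \<open>{u, v}\<close> being the pair of arcs \<open>(u, v)\<close>, \<open>(v, u)\<close>.

  The library predicate \<open>tree\<close> is not usable for such graphs: every edge would already count as a
  directed cycle \<open>u, v, u\<close> of length two. The cycles of the undirected graph are those of length at
  least three.
\<close>

definition undirected_tree :: "'a pair_pre_digraph \<Rightarrow> bool" where
  "undirected_tree G \<longleftrightarrow>
     pair_graph G \<and> Digraph_Component.connected (with_proj G) \<and>
     \<not> (\<exists>p. pre_digraph.cycle (with_proj G) p \<and> 3 \<le> length p)"

text \<open>In a symmetric digraph the out-degree is the degree of the undirected graph.\<close>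

definition leaf :: "'a pair_pre_digraph \<Rightarrow> 'a \<Rightarrow> bool" where
  "leaf G v \<longleftrightarrow> v \<in> pverts G \<and> out_degree (with_proj G) v = 1"

definition double_star :: "'a pair_pre_digraph \<Rightarrow> 'a \<Rightarrow> 'a \<Rightarrow> bool" where
  "double_star G a b \<longleftrightarrow>
     undirected_tree G \<and> a \<noteq> b \<and> {v \<in> pverts G. \<not> leaf G v} = {a, b} \<and> (a, b) \<in> parcs G \<and>
     (\<exists>x. leaf G x \<and> (a, x) \<in> parcs G) \<and> (\<exists>y. leaf G y \<and> (b, y) \<in> parcs G)"

definition subdivide_edge :: "'a pair_pre_digraph \<Rightarrow> 'a \<Rightarrow> 'a \<Rightarrow> 'a \<Rightarrow> 'a pair_pre_digraph" where
  "subdivide_edge G a b w =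
     \<lparr> pverts = insert w (pverts G),
       parcs = (parcs G - {(a, b), (b, a)}) \<union> {(a, w), (w, a), (b, w), (w, b)} \<rparr>"

definition augmented_double_star :: "'a pair_pre_digraph \<Rightarrow> bool" where
  "augmented_double_star G \<longleftrightarrow>
     (\<exists>S a b w. double_star S a b \<and> w \<notin> pverts S \<and> G = subdivide_edge S a b w)"

definition orientation :: "'a pair_pre_digraph \<Rightarrow> 'a pair_pre_digraph \<Rightarrow> bool" where
  "orientation D G \<longleftrightarrow>
     pverts D = pverts G \<and> parcs D \<subseteq> parcs G \<and>
     (\<forall>(u, v) \<in> parcs G. ((u, v) \<in> parcs D) \<noteq> ((v, u) \<in> parcs D))"

definition out_neighbors :: "'a pair_pre_digraph \<Rightarrow> 'a \<Rightarrow> 'a set" where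
  "out_neighbors D u = {v. (u, v) \<in> parcs D}"

definition can_force :: "'a pair_pre_digraph \<Rightarrow> 'a set \<Rightarrow> 'a \<Rightarrow> 'a \<Rightarrow> bool" where
  "can_force D S u w \<longleftrightarrow> u \<in> S \<and> out_neighbors D u - S = {w}"

fun performable :: "'a pair_pre_digraph \<Rightarrow> 'a set \<Rightarrow> ('a \<times> 'a) list \<Rightarrow> bool" where
  "performable D S [] \<longleftrightarrow> True"
| "performable D S ((u, w) # fs) \<longleftrightarrow> can_force D S u w \<and> performable D (insert w S) fs"

text \<open>The force \<open>u \<rightarrow> w\<close> is the pair \<open>(u, w)\<close>.\<close>

definition set_of_forces :: "'a pair_pre_digraph \<Rightarrow> 'a set \<Rightarrow> ('a \<times> 'a) set \<Rightarrow> bool" where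
  "set_of_forces D B F \<longleftrightarrow>
     (\<exists>fs. set fs = F \<and> performable D B fs \<and> \<not> (\<exists>u w. can_force D (B \<union> snd ` F) u w))"

fun blue_at :: "'a pair_pre_digraph \<Rightarrow> 'a set \<Rightarrow> ('a \<times> 'a) set \<Rightarrow> nat \<Rightarrow> 'a set" where
  "blue_at D B F 0 = B"
| "blue_at D B F (Suc t) =
     blue_at D B F t \<union> {w. \<exists>u. (u, w) \<in> F \<and> can_force D (blue_at D B F t) u w}"

definition pt_forces :: "'a pair_pre_digraph \<Rightarrow> 'a set \<Rightarrow> ('a \<times> 'a) set \<Rightarrow> enat" where
  "pt_forces D B F =
     (if \<exists>t. blue_at D B F t = pverts D then enat (LEAST t. blue_at D B F t = pverts D) else \<infinity>)"

text \<open>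
  The minima below are written as infima in the well-ordered type \<^typ>\<open>enat\<close>, where the infimum of a
  nonempty set is attained. For finite digraphs both index sets are nonempty.
\<close>

definition pt :: "'a pair_pre_digraph \<Rightarrow> 'a set \<Rightarrow> enat" where
  "pt D B = (INF F \<in> {F. set_of_forces D B F}. pt_forces D B F)"

definition throttling_number :: "'a pair_pre_digraph \<Rightarrow> enat" where
  "throttling_number D = (INF B \<in> Pow (pverts D). enat (card B) + pt D B)"

end

theory Submission
  imports Defs
begin

text \<open>
  The two centres \<open>a\<close> and \<open>b\<close> cover all edges and a vertex performs at most one force, so at most
  four vertices are ever forced and \<open>th \<ge> n - 4\<close>. For the upper bound, the edges joining \<open>a\<close> and
  \<open>b\<close> to one leaf each form an induced matching, so in every orientation their two heads can be
  forced simultaneously by their tails, whence \<open>th \<le> (n - 2) + 1\<close>.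
\<close>

section \<open>Throttling bounds for general digraphs\<close>

lemma performable_no_force_if_saturated:
  assumes "performable D S fs" "out_neighbors D u \<subseteq> S"
  shows "(u, v) \<notin> set fs"
  using assms
proof (induction D S fs rule: performable.induct)
  case (2 D S u' w fs)
  then show ?case by (auto simp: can_force_def)
qed simp

text \<open>When \<open>u\<close> forces, the forced vertex is its last white out-neighbor. Blue
  sets only grow along the list, so \<open>u\<close> never has a white out-neighbor again and cannot
  reappear as a tail.\<close>

lemma performable_single_valued:
  assumes "performable D S fs" "(u, v) \<in> set fs" "(u, v') \<in> set fs"
  shows "v = v'"
  using assms
proof (induction D S fs rule: performable.induct)
  case (2 D S u' w fs)
  have "(u', x) \<notin> set fs" for x
    using "2.prems"(1) performable_no_force_if_saturated[of D "insert w S" fs u' x]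
    by (auto simp: can_force_def)
  then show ?case using 2 by auto
qed simp

lemma performable_arc:
  assumes "performable D S fs" "(u, v) \<in> set fs"
  shows "(u, v) \<in> parcs D"
  using assms
  by (induction D S fs rule: performable.induct) (auto simp: can_force_def out_neighbors_def)

lemma blue_at_subset: "blue_at D B F t \<subseteq> B \<union> snd ` F"
  by (induction t) (auto simp: image_iff, force)

text \<open>Forces are arcs, so a forced vertex either lies in \<open>C\<close> or is forced by a
  member of \<open>C\<close>. There are at most \<open>card C\<close> vertices of the first kind,
  and at most as many of the second since each tail forces only once; hence the factor 2.\<close>

lemma card_forced_le_vertex_cover:
  assumes cover: "\<And>u v. (u, v) \<in> parcs D \<Longrightarrow> u \<in> C \<or> v \<in> C"
    and "finite C" and perf: "performable D B fs"
  shows "card (snd ` set fs) \<le> 2 * card C"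
proof -
  let ?F = "{f \<in> set fs. fst f \<in> C}"
  have "inj_on fst ?F"
    using performable_single_valued[OF perf] by (auto simp: inj_on_def)
  then have "card ?F \<le> card C"
    using \<open>finite C\<close> by (intro card_inj_on_le) auto
  then have "card (snd ` ?F) \<le> card C"
    using card_image_le[of ?F snd] by simp
  moreover have "snd ` set fs \<subseteq> C \<union> snd ` ?F"
    using cover performable_arc[OF perf] by (force simp: image_iff)
  then have "card (snd ` set fs) \<le> card (C \<union> snd ` ?F)"
    using \<open>finite C\<close> by (intro card_mono) auto
  ultimately show ?thesis
    using card_Un_le[of C "snd ` ?F"] by linarith
qed

text \<open>Propagation time is simply dropped: if \<open>B\<close> can turn everything blue, then
  all but at most \<open>2 * card C\<close> vertices already lie in \<open>B\<close>.\<close>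

lemma throttling_number_ge_vertex_cover:
  assumes cover: "\<And>u v. (u, v) \<in> parcs D \<Longrightarrow> u \<in> C \<or> v \<in> C"
    and "finite C" "finite (pverts D)"
  shows "enat (card (pverts D) - 2 * card C) \<le> throttling_number D"
  unfolding throttling_number_def
proof (rule INF_greatest)
  fix B assume "B \<in> Pow (pverts D)"
  then have "finite B" using \<open>finite (pverts D)\<close> finite_subset by blast
  show "enat (card (pverts D) - 2 * card C) \<le> enat (card B) + pt D B"
  proof (cases "\<exists>F t. set_of_forces D B F \<and> blue_at D B F t = pverts D")
    case True
    then obtain fs t where "performable D B fs" "blue_at D B (set fs) t = pverts D"
      by (auto simp: set_of_forces_def)
    then have "card (pverts D) \<le> card (B \<union> snd ` set fs)"
      using blue_at_subset[of D B "set fs" t] \<open>finite B\<close> by (auto intro!: card_mono)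
    also have "\<dots> \<le> card B + 2 * card C"
      using card_Un_le[of B "snd ` set fs"]
        card_forced_le_vertex_cover[OF cover \<open>finite C\<close> \<open>performable D B fs\<close>] by linarith
    finally have "enat (card (pverts D) - 2 * card C) \<le> enat (card B)" by simp
    then show ?thesis by (meson add_increasing2 zero_le)
  next
    case False
    \<comment> \<open>When no set of forces of \<open>B\<close> reaches all vertices, every term of
      the infimum is infinite, and so is the infimum.\<close>
    then have "pt_forces D B F = \<infinity>" if "set_of_forces D B F" for F
      using that by (simp add: pt_forces_def)
    then have "\<infinity> \<le> pt D B"
      unfolding pt_def by (intro INF_greatest) simp
    then show ?thesis by simp
  qed
qed

text \<open>Leave only the two heads white. Each tail is blue and sees exactly one white vertex, its
  own head, so both forces happen in the first time step and the cost is two vertices saved against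
  one step spent.\<close>

lemma throttling_number_less_if_two_independent_arcs:
  assumes "finite (pverts D)" and wf: "\<And>u v. (u, v) \<in> parcs D \<Longrightarrow> u \<in> pverts D \<and> v \<in> pverts D"
    and arcs: "(u1, w1) \<in> parcs D" "(u2, w2) \<in> parcs D"
    and nonarcs: "(u1, w2) \<notin> parcs D" "(u2, w1) \<notin> parcs D"
    and distinct: "w1 \<noteq> w2" "u1 \<notin> {w1, w2}" "u2 \<notin> {w1, w2}"
  shows "throttling_number D < enat (card (pverts D))"
proof -
  define B where "B = pverts D - {w1, w2}"
  define F where "F = {(u1, w1), (u2, w2)}"
  have out: "out_neighbors D u \<subseteq> pverts D" for u
    using wf by (auto simp: out_neighbors_def)
  \<comment> \<open>\<open>performable\<close> applies the forces one after the other and therefore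
    needs \<open>f1\<close> and \<open>f2'\<close>; the simultaneous step of \<open>blue_at\<close>
    needs \<open>f1\<close> and \<open>f2\<close>.\<close>
  have f1: "can_force D B u1 w1" and f2: "can_force D B u2 w2"
    and f2': "can_force D (insert w1 B) u2 w2"
    using arcs nonarcs distinct wf by (auto simp: can_force_def B_def out_neighbors_def)
  have all: "B \<union> snd ` F = pverts D"
    using arcs wf by (auto simp: B_def F_def)
  have "set_of_forces D B F"
    unfolding set_of_forces_def
  proof (intro exI[of _ "[(u1, w1), (u2, w2)]"] conjI)
    show "\<not> (\<exists>u w. can_force D (B \<union> snd ` F) u w)"
      unfolding all can_force_def using out by blast
  qed (use f1 f2' in \<open>auto simp: F_def\<close>)
  moreover have "blue_at D B F 1 = pverts D"
  proof
    show "blue_at D B F 1 \<subseteq> pverts D" using blue_at_subset[of D B F 1] all by simp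
    show "pverts D \<subseteq> blue_at D B F 1" using f1 f2 by (auto simp: B_def F_def)
  qed
  then have "\<exists>t. blue_at D B F t = pverts D"
    and "(LEAST t. blue_at D B F t = pverts D) \<le> 1"
    by (blast, rule Least_le)
  then have "pt_forces D B F \<le> 1"
    by (simp add: pt_forces_def one_enat_def)
  ultimately have "pt D B \<le> 1"
    unfolding pt_def by (intro INF_lower2[of F]) auto
  then have "enat (card B) + pt D B \<le> enat (card B + 1)"
    by (metis add_left_mono one_enat_def plus_enat_simps(1))
  moreover have "throttling_number D \<le> enat (card B) + pt D B"
    unfolding throttling_number_def by (rule INF_lower) (auto simp: B_def)
  moreover have "card (pverts D) = card B + 2"
  proof -
    have "card {w1, w2} = 2" "{w1, w2} \<subseteq> pverts D" using arcs wf distinct by auto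
    then show ?thesis
      using card_mono[OF \<open>finite (pverts D)\<close>, of "{w1, w2}"]
      by (simp add: B_def card_Diff_subset)
  qed
  then have "enat (card B + 1) < enat (card (pverts D))" by simp
  ultimately show ?thesis by (meson le_less_trans)
qed

section \<open>Structure of double stars and augmented double stars\<close>

lemma leaf_neighbor_unique:
  assumes "leaf G x" "(x, u) \<in> parcs G" "(x, v) \<in> parcs G"
  shows "u = v"
proof -
  have "card {e \<in> parcs G. fst e = x} = 1"
    using assms(1) by (simp add: leaf_def out_degree_def out_arcs_def)
  then obtain e where "{e \<in> parcs G. fst e = x} = {e}" by (rule card_1_singletonE)
  moreover have "(x, u) \<in> {e \<in> parcs G. fst e = x}" "(x, v) \<in> {e \<in> parcs G. fst e = x}"
    using assms(2,3) by simp_all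
  ultimately show ?thesis by (metis prod.inject singletonD)
qed

lemma pair_graph_arc_sym:
  assumes "pair_graph G" "(u, v) \<in> parcs G"
  shows "(v, u) \<in> parcs G"
proof -
  interpret pair_graph G by fact
  show ?thesis using assms(2) by (rule arcs_symmetric)
qed

lemma pair_graph_arc_verts:
  assumes "pair_graph G" "(u, v) \<in> parcs G"
  shows "u \<in> pverts G \<and> v \<in> pverts G"
proof -
  interpret pair_graph G by fact
  show ?thesis using arc_fst_in_verts[OF assms(2)] arc_snd_in_verts[OF assms(2)] by simp
qed

text \<open>Connectedness is strong connectedness of the symmetrization. The arcs of
  \<open>G\<close> are already symmetric, so a path of the symmetrization is a path of
  \<open>G\<close> and cannot leave \<open>X\<close>.\<close>

lemma connected_closed_subset:
  assumes conn: "Digraph_Component.connected (with_proj G)" and "pair_graph G"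
    and closed: "\<And>u v. u \<in> X \<Longrightarrow> (u, v) \<in> parcs G \<Longrightarrow> v \<in> X"
    and "x \<in> X" "x \<in> pverts G" "y \<in> pverts G"
  shows "y \<in> X"
proof -
  have "x \<rightarrow>\<^sup>*\<^bsub>with_proj (mk_symmetric (with_proj G))\<^esub> y"
    using conn assms(5,6) by (auto simp: connected_def strongly_connected_def)
  then show ?thesis
    unfolding reachable_def
  proof (induction rule: rtrancl_on_induct)
    case (step u v)
    then have "(u, v) \<in> parcs G"
      by (auto simp: mk_symmetric_def intro: pair_graph_arc_sym[OF \<open>pair_graph G\<close>])
    then show ?case using step closed by blast
  qed (use \<open>x \<in> X\<close> in simp)
qed

text \<open>An edge joining two leaves would be a whole connected component, since neither end has
  another neighbor; connectedness would then place \<open>a\<close> on that edge.\<close>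

lemma double_star_centers_cover:
  assumes ds: "double_star S a b" and arc: "(u, v) \<in> parcs S"
  shows "u \<in> {a, b} \<or> v \<in> {a, b}"
proof (rule ccontr)
  assume contra: "\<not> ?thesis"
  have pg: "pair_graph S" and centers: "{v \<in> pverts S. \<not> leaf S v} = {a, b}"
    and conn: "Digraph_Component.connected (with_proj S)"
    using ds unfolding double_star_def undirected_tree_def by blast+
  have uv: "u \<in> pverts S" "v \<in> pverts S" using pair_graph_arc_verts[OF pg arc] by auto
  then have leaves: "leaf S u" "leaf S v" using centers contra by blast+
  have "a \<in> {u, v}"
  proof (rule connected_closed_subset[OF conn pg, where x = u])
    show "z \<in> {u, v}" if "y \<in> {u, v}" "(y, z) \<in> parcs S" for y z
      using that leaf_neighbor_unique[OF leaves(1) arc, of z]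
        leaf_neighbor_unique[OF leaves(2) pair_graph_arc_sym[OF pg arc], of z] by auto
    show "a \<in> pverts S" using centers by blast
  qed (use uv in auto)
  then show False using contra by auto
qed

text \<open>Among \<open>a\<close>, \<open>x\<close>, \<open>b\<close>, \<open>y\<close> the only
  edge of the double star between \<open>{a, x}\<close> and \<open>{b, y}\<close> is the central
  one. Subdividing deletes it, and every new edge contains \<open>w\<close>, which is none of the
  four; so the two leaf edges become an induced matching.\<close>

lemma augmented_double_starE:
  assumes "augmented_double_star G"
  obtains a b x y where "finite (pverts G)"
    and "\<And>u v. (u, v) \<in> parcs G \<Longrightarrow> u \<in> pverts G \<and> v \<in> pverts G"
    and "\<And>u v. (u, v) \<in> parcs G \<Longrightarrow> u \<in> {a, b} \<or> v \<in> {a, b}"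
    and "\<And>u v. u \<in> {a, x} \<Longrightarrow> v \<in> {b, y} \<Longrightarrow> (u, v) \<notin> parcs G \<and> (v, u) \<notin> parcs G"
    and "(a, x) \<in> parcs G" "(b, y) \<in> parcs G" "distinct [a, x, b, y]"
proof -
  obtain S a b w where ds: "double_star S a b" and w: "w \<notin> pverts S"
    and G: "G = subdivide_edge S a b w"
    using assms unfolding augmented_double_star_def by blast
  have pg: "pair_graph S" and "a \<noteq> b" and centers: "{v \<in> pverts S. \<not> leaf S v} = {a, b}"
    using ds unfolding double_star_def undirected_tree_def by blast+
  have "finite (pverts S)"
    using pg by (simp add: pair_graph_def pair_digraph_def pair_fin_digraph.pair_finite_verts)
  obtain x y where x: "leaf S x" "(a, x) \<in> parcs S" and y: "leaf S y" "(b, y) \<in> parcs S"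
    using ds unfolding double_star_def by blast
  have ab: "a \<in> pverts S" "b \<in> pverts S" "\<not> leaf S a" "\<not> leaf S b" using centers by blast+
  have wf: "u \<in> pverts S \<and> v \<in> pverts S" if "(u, v) \<in> parcs S" for u v
    using that pair_graph_arc_verts[OF pg] by blast
  have ne: "x \<notin> {a, b}" "y \<notin> {a, b}" "w \<notin> {a, b, x, y}"
    using x y ab w wf by auto
  have xb: "(x, b) \<notin> parcs S" and ya: "(y, a) \<notin> parcs S"
    using leaf_neighbor_unique[OF x(1) pair_graph_arc_sym[OF pg x(2)], of b]
      leaf_neighbor_unique[OF y(1) pair_graph_arc_sym[OF pg y(2)], of a] \<open>a \<noteq> b\<close> by auto
  \<comment> \<open>A common leaf would be adjacent to both centers.\<close>
  have "x \<noteq> y" using xb y pair_graph_arc_sym[OF pg] by blast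
  have xy: "(x, y) \<notin> parcs S" "(y, x) \<notin> parcs S"
    using double_star_centers_cover[OF ds] ne by blast+
  have bx: "(b, x) \<notin> parcs S" and ay: "(a, y) \<notin> parcs S"
    using xb ya pair_graph_arc_sym[OF pg] by blast+
  show thesis
  proof (rule that[of a b x y])
    show "u \<in> pverts G \<and> v \<in> pverts G" if "(u, v) \<in> parcs G" for u v
      using that wf ab by (auto simp: G subdivide_edge_def)
    show "u \<in> {a, b} \<or> v \<in> {a, b}" if "(u, v) \<in> parcs G" for u v
      using that double_star_centers_cover[OF ds, of u v] by (auto simp: G subdivide_edge_def)
    show "(u, v) \<notin> parcs G \<and> (v, u) \<notin> parcs G" if "u \<in> {a, x}" "v \<in> {b, y}" for u v
      using that ne xb ya xy bx ay w \<open>a \<noteq> b\<close> by (auto simp: G subdivide_edge_def)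
  qed (use \<open>finite (pverts S)\<close> ne x y \<open>a \<noteq> b\<close> \<open>x \<noteq> y\<close> in \<open>auto simp: G subdivide_edge_def\<close>)
qed

section \<open>Numerical comparison and conclusion\<close>

lemma ceiling_two_sqrt_bound:
  assumes "12 \<le> n"
  shows "nat \<lceil>2 * sqrt (real n) - 1\<rceil> < n - 4"
proof -
  \<comment> \<open>Shifting by 12 turns the difference of the two sides of the squared inequality
    into a polynomial in \<open>m\<close> with positive coefficients.\<close>
  define m where "m = real n - 12"
  have "4 * real n \<le> (real n - 4)\<^sup>2"
  proof -
    have "(real n - 4)\<^sup>2 - 4 * real n = m\<^sup>2 + 12 * m + 16"
      by (simp add: m_def power2_eq_square algebra_simps)
    moreover have "0 \<le> m" using assms by (simp add: m_def)
    ultimately show ?thesis by (smt (verit) zero_le_power2)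
  qed
  then have "sqrt (4 * real n) \<le> real n - 4"
    using assms by (intro real_le_lsqrt) auto
  \<comment> \<open>The bound is written as an integer so that it survives the ceiling; strictness
    comes from \<open>n - 5 < n - 4\<close>.\<close>
  then have "2 * sqrt (real n) - 1 \<le> of_int (int n - 5)"
    by (simp add: real_sqrt_mult)
  then have "\<lceil>2 * sqrt (real n) - 1\<rceil> \<le> int n - 5" by (rule ceiling_le)
  then show ?thesis using assms by linarith
qed

theorem theorem3p12:
  fixes G D :: "'a pair_pre_digraph" and n :: nat
  assumes "augmented_double_star G"
    and "card (pverts G) = n"
    and "n \<ge> 12"
    and "orientation D G"
  shows "enat (nat \<lceil>2 * sqrt (real n) - 1\<rceil>) < throttling_number D \<and> throttling_number D < enat n"
proof -
  obtain a b x y where fin: "finite (pverts G)"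
    and wf: "\<And>u v. (u, v) \<in> parcs G \<Longrightarrow> u \<in> pverts G \<and> v \<in> pverts G"
    and cover: "\<And>u v. (u, v) \<in> parcs G \<Longrightarrow> u \<in> {a, b} \<or> v \<in> {a, b}"
    and indep: "\<And>u v. u \<in> {a, x} \<Longrightarrow> v \<in> {b, y} \<Longrightarrow> (u, v) \<notin> parcs G \<and> (v, u) \<notin> parcs G"
    and edges: "(a, x) \<in> parcs G" "(b, y) \<in> parcs G" and dist: "distinct [a, x, b, y]"
    by (rule augmented_double_starE[OF assms(1)]) (rule that; blast)
  have V: "pverts D = pverts G" and sub: "parcs D \<subseteq> parcs G"
    using assms(4) by (auto simp: orientation_def)
  have orient: "(u, v) \<in> parcs D \<or> (v, u) \<in> parcs D" if "(u, v) \<in> parcs G" for u v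
    using assms(4) that by (fastforce simp: orientation_def)
  have "card {a, b} = 2" using dist by simp
  then have "enat (n - 4) \<le> throttling_number D"
    using throttling_number_ge_vertex_cover[of D "{a, b}"] cover sub fin V assms(2) by auto
  moreover have "enat (nat \<lceil>2 * sqrt (real n) - 1\<rceil>) < enat (n - 4)"
    using ceiling_two_sqrt_bound[OF assms(3)] by simp
  moreover have "throttling_number D < enat n"
  proof -
    \<comment> \<open>Whichever direction the edge receives, call its tail \<open>u1\<close> and its
      head \<open>w1\<close>; likewise for the edge at \<open>b\<close>.\<close>
    obtain u1 w1 where 1: "(u1, w1) \<in> parcs D" "u1 \<in> {a, x}" "w1 \<in> {a, x}" "u1 \<noteq> w1"
      using orient[OF edges(1)] dist by auto
    obtain u2 w2 where 2: "(u2, w2) \<in> parcs D" "u2 \<in> {b, y}" "w2 \<in> {b, y}" "u2 \<noteq> w2"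
      using orient[OF edges(2)] dist by auto
    have "throttling_number D < enat (card (pverts D))"
    proof (rule throttling_number_less_if_two_independent_arcs[OF _ _ 1(1) 2(1)])
      show "finite (pverts D)" using fin V by simp
      show "u \<in> pverts D \<and> v \<in> pverts D" if "(u, v) \<in> parcs D" for u v
        using that wf sub V by auto
      \<comment> \<open>\<open>indep\<close> excludes both directions between the two edges, so it
        applies whichever ends turned out to be the tails.\<close>
      show "(u1, w2) \<notin> parcs D" "(u2, w1) \<notin> parcs D"
        using indep[OF 1(2) 2(3)] indep[OF 1(3) 2(2)] sub by auto
      show "w1 \<noteq> w2" "u1 \<notin> {w1, w2}" "u2 \<notin> {w1, w2}"
        using 1(2-) 2(2-) dist by auto
    qed
    then show ?thesis using V assms(2) by simp
  qed
  ultimately show ?thesis by (meson less_le_trans)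
qed

end
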